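(* Let $m_1<0<n_1$ and $m_2<0<n_2$ be integers. The $\mathbb{Z}$-graded algebras $E_{(m_1,n_1)}^{(\infty,\infty)}$ and $E_{(m_2,n_2)}^{(\infty,\infty)}$ are $\mathbb{Z}$-isomorphic if and only if $m_1=m_2$ and $n_1=n_2$.
   Context: $F$ is a field of characteristic zero; all algebras are associative and unitary over $F$. $E$ is the infinite dimensional Grassmann algebra over $F$: $L$ is the vector space with basis $e_1,e_2,\ldots$, and $E$ has basis $B_E$ consisting of $1$ and all products $e_{i_1}\cdots e_{i_k}$ with $i_1<\cdots<i_k$, $k\ge 1$, with multiplication induced by $e_ie_j=-e_je_i$ for all $i,j$. For integers $m<n$, the $\mathbb{Z}$-graded algebra $E_{(m,n)}^{(\infty,\infty)}=\bigoplus_{r\in\mathbb{Z}}A_r$ is defined as follows: split the set $\{e_1,e_2,\ldots\}$ into two disjoint infinite subsets, spanning subspaces $L_m^{\infty}$ and $L_n^{\infty}$ with $L=L_m^{\infty}\oplus L_n^{\infty}$; set $\|e_k\|=m$ if $e_k\in L_m^\infty$ and $\|e_k\|=n$ if $e_k\in L_n^\infty$, and $\|e_{k_1}\cdots e_{k_s}\|=\|e_{k_1}\|+\cdots+\|e_{k_s}\|$ (and $\|1\|=0$); $A_r$ is the span of the elements of $B_E$ of degree $r$. Two $\mathbb{Z}$-graded algebras $A=\bigoplus_r A_r$ and $B=\bigoplus_r B_r$ are $\mathbb{Z}$-isomorphic if there is an algebra isomorphism $\varphi\colon A\to B$ with $\varphi(A_r)=B_r$ for all $r\in\mathbb{Z}$.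 *)

theory Defs
  imports Complex_Main
begin

section \<open>The Grassmann algebra on countably many generators\<close>

text \<open>
  The generators are indexed from 0. The basis monomial \<open>e\<^bsub>i1\<^esub> \<cdots> e\<^bsub>ik\<^esub>\<close>
  with \<open>i1 < \<cdots> < ik\<close> is indexed by the finite set \<open>{i1, \<dots>, ik}\<close>, and the monomial 1 by
  the empty set; an element of the algebra is the family of its coordinates in this basis.
\<close>

typedef (overloaded) 'a grassmann =
  "{f :: nat set \<Rightarrow> 'a::zero. finite {S. f S \<noteq> 0} \<and> (\<forall>S. f S \<noteq> 0 \<longrightarrow> finite S)}"
  morphisms gcoeff Abs_grassmann
  by (rule exI[of _ "\<lambda>_. 0"]) simp

setup_lifting type_definition_grassmann

lemma gcoeff_finite_support: "finite {S. gcoeff x S \<noteq> 0}"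
  using gcoeff[of x] by simp

lemma gcoeff_infinite [simp]: "infinite S \<Longrightarrow> gcoeff x S = 0"
  using gcoeff[of x] by auto

lemma grassmann_eqI: "(\<And>S. finite S \<Longrightarrow> gcoeff x S = gcoeff y S) \<Longrightarrow> x = y"
  by (metis ext gcoeff_infinite gcoeff_inject)

text \<open>
  The sign that arises from sorting the product of the monomials of two disjoint sets:
  every pair that has to be interchanged contributes a factor \<open>-1\<close>.
\<close>

definition ginversions :: "nat set \<Rightarrow> nat set \<Rightarrow> (nat \<times> nat) set" where
  "ginversions S T = {(s, t). s \<in> S \<and> t \<in> T \<and> t < s}"

definition gsign :: "nat set \<Rightarrow> nat set \<Rightarrow> 'a::ring_1" where
  "gsign S T = (-1) ^ card (ginversions S T)"

lemma finite_ginversions: "finite S \<Longrightarrow> finite T \<Longrightarrow> finite (ginversions S T)"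
  by (rule finite_subset[of _ "S \<times> T"]) (auto simp: ginversions_def)

lemma gsign_empty [simp]: "gsign {} T = 1" "gsign S {} = 1"
  by (simp_all add: gsign_def ginversions_def)

lemma gsign_union_left:
  assumes "finite S" "finite T" "finite U" "S \<inter> T = {}"
  shows "gsign (S \<union> T) U = gsign S U * (gsign T U :: 'a::ring_1)"
proof -
  have "ginversions (S \<union> T) U = ginversions S U \<union> ginversions T U"
    "ginversions S U \<inter> ginversions T U = {}"
    using assms by (auto simp: ginversions_def)
  with assms show ?thesis
    by (simp add: gsign_def card_Un_disjoint finite_ginversions power_add)
qed

lemma gsign_union_right:
  assumes "finite S" "finite T" "finite U" "T \<inter> U = {}"
  shows "gsign S (T \<union> U) = gsign S T * (gsign S U :: 'a::ring_1)"
proof -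
  have "ginversions S (T \<union> U) = ginversions S T \<union> ginversions S U"
    "ginversions S T \<inter> ginversions S U = {}"
    using assms by (auto simp: ginversions_def)
  with assms show ?thesis
    by (simp add: gsign_def card_Un_disjoint finite_ginversions power_add)
qed

instantiation grassmann :: (ab_group_add) ab_group_add
begin

lift_definition zero_grassmann :: "'a grassmann" is "\<lambda>_. 0" by simp

lift_definition plus_grassmann :: "'a grassmann \<Rightarrow> 'a grassmann \<Rightarrow> 'a grassmann"
  is "\<lambda>f g S. f S + g S"
proof -
  fix f g :: "nat set \<Rightarrow> 'a"
  assume f: "finite {S. f S \<noteq> 0} \<and> (\<forall>S. f S \<noteq> 0 \<longrightarrow> finite S)"
    and g: "finite {S. g S \<noteq> 0} \<and> (\<forall>S. g S \<noteq> 0 \<longrightarrow> finite S)"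
  have "finite {S. f S + g S \<noteq> 0}"
    by (rule finite_subset[of _ "{S. f S \<noteq> 0} \<union> {S. g S \<noteq> 0}"]) (use f g in auto)
  moreover have "finite S" if "f S + g S \<noteq> 0" for S
    using that f g by (metis add.right_neutral)
  ultimately show "finite {S. f S + g S \<noteq> 0} \<and> (\<forall>S. f S + g S \<noteq> 0 \<longrightarrow> finite S)"
    by blast
qed

lift_definition uminus_grassmann :: "'a grassmann \<Rightarrow> 'a grassmann" is "\<lambda>f S. - f S" by simp

definition minus_grassmann :: "'a grassmann \<Rightarrow> 'a grassmann \<Rightarrow> 'a grassmann" where
  "minus_grassmann x y = x + - y"

instance
  by standard (unfold minus_grassmann_def, (transfer, auto simp: fun_eq_iff algebra_simps)+)

end

lemma gcoeff_add [simp]: "gcoeff (x + y) S = gcoeff x S + gcoeff y S"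
  by transfer simp

lemma gcoeff_zero [simp]: "gcoeff 0 S = 0"
  by transfer simp

lemma gcoeff_uminus [simp]: "gcoeff (- x) S = - gcoeff x S"
  by transfer simp

text \<open>
  The product is the bilinear extension of
  \<open>e\<^sub>S * e\<^sub>T = gsign S T * e\<^bsub>S \<union> T\<^esub>\<close> for disjoint \<open>S\<close>, \<open>T\<close>
  and \<open>e\<^sub>S * e\<^sub>T = 0\<close> otherwise. For infinite \<open>U\<close> the sum below has an infinite index set
  and hence is 0, as required.
\<close>

instantiation grassmann :: (comm_ring_1) ring_1
begin

lift_definition one_grassmann :: "'a grassmann" is "\<lambda>S. if S = {} then 1 else 0" by simp

lift_definition times_grassmann :: "'a grassmann \<Rightarrow> 'a grassmann \<Rightarrow> 'a grassmann"
  is "\<lambda>f g U. \<Sum>S\<in>Pow U. gsign S (U - S) * f S * g (U - S)"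
proof -
  fix f g :: "nat set \<Rightarrow> 'a"
  assume f: "finite {S. f S \<noteq> 0} \<and> (\<forall>S. f S \<noteq> 0 \<longrightarrow> finite S)"
    and g: "finite {S. g S \<noteq> 0} \<and> (\<forall>S. g S \<noteq> 0 \<longrightarrow> finite S)"
  let ?h = "\<lambda>U. \<Sum>S\<in>Pow U. gsign S (U - S) * f S * g (U - S)"
  have "{U. ?h U \<noteq> 0} \<subseteq> (\<lambda>(S, T). S \<union> T) ` ({S. f S \<noteq> 0} \<times> {S. g S \<noteq> 0})"
  proof
    fix U assume "U \<in> {U. ?h U \<noteq> 0}"
    then obtain S where "S \<in> Pow U" "gsign S (U - S) * f S * g (U - S) \<noteq> 0"
      by (metis (mono_tags, lifting) mem_Collect_eq sum.neutral)
    then have "f S \<noteq> 0" "g (U - S) \<noteq> 0" "U = S \<union> (U - S)" by auto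
    then show "U \<in> (\<lambda>(S, T). S \<union> T) ` ({S. f S \<noteq> 0} \<times> {S. g S \<noteq> 0})"
      by (intro image_eqI[of _ _ "(S, U - S)"]) auto
  qed
  moreover have "finite ((\<lambda>(S, T). S \<union> T) ` ({S. f S \<noteq> 0} \<times> {S. g S \<noteq> 0}))"
    using f g by simp
  ultimately have "finite {U. ?h U \<noteq> 0}" by (rule finite_subset)
  moreover have "finite U" if "?h U \<noteq> 0" for U
    using that by (metis finite_Pow_iff sum.infinite)
  ultimately show "finite {U. ?h U \<noteq> 0} \<and> (\<forall>U. ?h U \<noteq> 0 \<longrightarrow> finite U)"
    by blast
qed

lemma gcoeff_mult:
  "gcoeff (x * y) U = (\<Sum>S\<in>Pow U. gsign S (U - S) * gcoeff x S * gcoeff y (U - S))"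
  for x y :: "'a grassmann"
  by transfer simp

lemma gcoeff_one: "gcoeff (1 :: 'a grassmann) S = (if S = {} then 1 else 0)"
  by transfer simp

instance
proof
  fix x y z :: "'a grassmann"
  show "x * y * z = x * (y * z)"
  proof (rule grassmann_eqI)
    fix U :: "nat set" assume U: "finite U"
    let ?I = "SIGMA S:Pow U. Pow S" and ?J = "SIGMA T:Pow U. Pow (U - T)"
    let ?F = "\<lambda>(S, T). gsign S (U - S) * (gsign T (S - T) * gcoeff x T * gcoeff y (S - T))
      * gcoeff z (U - S)"
    let ?G = "\<lambda>(T, V). gsign T (U - T) * gcoeff x T *
      (gsign V (U - T - V) * gcoeff y V * gcoeff z (U - T - V))"
    have fin: "finite S" if "S \<subseteq> U" for S using that U finite_subset by blast
    have "gcoeff (x * y * z) U = sum ?F ?I"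
      unfolding gcoeff_mult sum_distrib_left sum_distrib_right using U fin
      by (subst sum.Sigma) (auto simp: case_prod_unfold)
    also have "\<dots> = sum ?G ?J"
    proof (rule sum.reindex_bij_witness[of _ "\<lambda>(T, V). (T \<union> V, T)" "\<lambda>(S, T). (T, S - T)"])
      fix p assume "p \<in> ?I"
      then obtain S T where p: "p = (S, T)" "S \<subseteq> U" "T \<subseteq> S" by auto
      show "(case case p of (S, T) \<Rightarrow> (T, S - T) of (T, V) \<Rightarrow> (T \<union> V, T)) = p"
        "(case p of (S, T) \<Rightarrow> (T, S - T)) \<in> ?J"
        using p by auto
      have eqs: "T \<union> (S - T) = S" "(S - T) \<union> (U - S) = U - T" "U - T - (S - T) = U - S"
        using p by auto
      have "gsign (T \<union> (S - T)) (U - S) = gsign T (U - S) * (gsign (S - T) (U - S) :: 'a)"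
        using p by (intro gsign_union_left fin) auto
      moreover have "gsign T ((S - T) \<union> (U - S)) = gsign T (S - T) * (gsign T (U - S) :: 'a)"
        using p by (intro gsign_union_right fin) auto
      ultimately have sgn: "gsign S (U - S) * gsign T (S - T) =
          gsign T (U - T) * (gsign (S - T) (U - S) :: 'a)"
        by (simp only: eqs mult_ac)
      let ?c = "gcoeff x T * gcoeff y (S - T) * gcoeff z (U - S)"
      have "?G (T, S - T) = gsign T (U - T) * gsign (S - T) (U - S) * ?c"
        by (simp only: prod.case eqs mult_ac)
      also have "\<dots> = gsign S (U - S) * gsign T (S - T) * ?c"
        by (simp only: sgn)
      also have "\<dots> = ?F p"
        by (simp only: p(1) prod.case mult_ac)
      finally show "?G (case p of (S, T) \<Rightarrow> (T, S - T)) = ?F p"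
        by (simp only: p(1) prod.case)
    next
      fix q assume "q \<in> ?J"
      then show "(case case q of (T, V) \<Rightarrow> (T \<union> V, T) of (S, T) \<Rightarrow> (T, S - T)) = q"
        "(case q of (T, V) \<Rightarrow> (T \<union> V, T)) \<in> ?I"
        by auto
    qed
    also have "\<dots> = gcoeff (x * (y * z)) U"
      unfolding gcoeff_mult sum_distrib_left using U fin
      by (subst sum.Sigma) (auto simp: case_prod_unfold)
    finally show "gcoeff (x * y * z) U = gcoeff (x * (y * z)) U" .
  qed
  show "1 * x = x"
  proof (rule grassmann_eqI)
    fix U :: "nat set" assume "finite U"
    then have "gcoeff (1 * x) U = (\<Sum>S\<in>Pow U. if S = {} then gcoeff x U else 0)"
      unfolding gcoeff_mult by (intro sum.cong) (auto simp: gcoeff_one)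
    with \<open>finite U\<close> show "gcoeff (1 * x) U = gcoeff x U" by simp
  qed
  show "x * 1 = x"
  proof (rule grassmann_eqI)
    fix U :: "nat set" assume "finite U"
    then have "gcoeff (x * 1) U = (\<Sum>S\<in>Pow U. if S = U then gcoeff x U else 0)"
      unfolding gcoeff_mult by (intro sum.cong) (auto simp: gcoeff_one)
    with \<open>finite U\<close> show "gcoeff (x * 1) U = gcoeff x U" by simp
  qed
  show "(x + y) * z = x * z + y * z" "x * (y + z) = x * y + x * z"
    by (rule grassmann_eqI; simp add: gcoeff_mult algebra_simps sum.distrib)+
  have "gcoeff (0 :: 'a grassmann) {} \<noteq> gcoeff 1 {}" by (simp add: gcoeff_one)
  then show "(0 :: 'a grassmann) \<noteq> 1" by metis
qed

end

lift_definition gscale :: "'a::comm_ring_1 \<Rightarrow> 'a grassmann \<Rightarrow> 'a grassmann"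
  is "\<lambda>c f S. c * f S"
  by (auto elim: finite_subset[rotated] dest: mult_not_zero)

lemma gcoeff_scale [simp]: "gcoeff (gscale c x) S = c * gcoeff x S"
  by transfer simp

interpretation grassmann: vector_space "gscale :: 'a::field \<Rightarrow> 'a grassmann \<Rightarrow> 'a grassmann"
  by unfold_locales (rule grassmann_eqI; simp add: algebra_simps)+

lemma gscale_mult_left: "gscale c x * y = gscale c (x * y)"
  and gscale_mult_right: "x * gscale c y = gscale c (x * y)"
  by (rule grassmann_eqI; simp add: gcoeff_mult sum_distrib_left algebra_simps)+

lift_definition gmonom :: "nat set \<Rightarrow> 'a::zero_neq_one grassmann"
  is "\<lambda>T S. if finite T \<and> S = T then 1 else 0"
  by auto

abbreviation ggen :: "nat \<Rightarrow> 'a::zero_neq_one grassmann" where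
  "ggen i \<equiv> gmonom {i}"

lemma gcoeff_monom: "gcoeff (gmonom T) S = (if finite T \<and> S = T then 1 else 0)"
  by transfer simp

lemma gmonom_empty: "gmonom {} = (1 :: 'a::comm_ring_1 grassmann)"
  by (rule grassmann_eqI) (simp add: gcoeff_monom gcoeff_one)

lemma gmonom_mult:
  assumes "finite S" "finite T"
  shows "gmonom S * gmonom T =
    (if S \<inter> T = {} then gscale (gsign S T) (gmonom (S \<union> T)) else (0 :: 'a::comm_ring_1 grassmann))"
proof (rule grassmann_eqI)
  fix U :: "nat set" assume U: "finite U"
  have "gcoeff (gmonom S * gmonom T :: 'a grassmann) U =
      (\<Sum>V\<in>Pow U. if V = S then (if U - S = T then gsign S T else 0) else 0)"
    unfolding gcoeff_mult using assms by (intro sum.cong) (auto simp: gcoeff_monom)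
  also have "\<dots> = (if S \<subseteq> U \<and> U - S = T then gsign S T else 0)"
    using U by simp
  also have "\<dots> = gcoeff (if S \<inter> T = {} then gscale (gsign S T) (gmonom (S \<union> T)) else 0) U"
    using assms by (auto simp: gcoeff_monom)
  finally show "gcoeff (gmonom S * gmonom T :: 'a grassmann) U =
    gcoeff (if S \<inter> T = {} then gscale (gsign S T) (gmonom (S \<union> T)) else 0) U" .
qed

lemma ggen_anticommute: "ggen i * ggen j = - (ggen j * ggen i :: 'a::comm_ring_1 grassmann)"
proof (cases i j rule: linorder_cases)
  case equal
  then show ?thesis by (simp add: gmonom_mult)
next
  case less
  then have "ginversions {i} {j} = {}" "ginversions {j} {i} = {(j, i)}"
    by (auto simp: ginversions_def)
  with less show ?thesis
    by (intro grassmann_eqI) (auto simp: gmonom_mult gsign_def insert_commute)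
next
  case greater
  then have "ginversions {j} {i} = {}" "ginversions {i} {j} = {(i, j)}"
    by (auto simp: ginversions_def)
  with greater show ?thesis
    by (intro grassmann_eqI) (auto simp: gmonom_mult gsign_def insert_commute)
qed

lemma gmonom_conv_prod_list:
  "sorted xs \<Longrightarrow> distinct xs \<Longrightarrow>
    gmonom (set xs) = (prod_list (map ggen xs) :: 'a::comm_ring_1 grassmann)"
proof (induction xs)
  case Nil
  then show ?case by (simp add: gmonom_empty)
next
  case (Cons i xs)
  have "ginversions {i} (set xs) = {}"
    using Cons.prems by (auto simp: ginversions_def)
  then have "gmonom (set (i # xs)) = (ggen i * gmonom (set xs) :: 'a grassmann)"
    using Cons.prems by (intro grassmann_eqI) (auto simp: gmonom_mult gsign_def)
  with Cons show ?case by simp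
qed

section \<open>The grading and graded isomorphism\<close>

text \<open>
  \<open>I\<close> is the set of indices of the generators of degree \<open>m\<close>; the other generators have degree \<open>n\<close>.
  The splitting into two infinite sets amounts to \<open>infinite I\<close> and \<open>infinite (- I)\<close>.
\<close>

definition gdegree :: "nat set \<Rightarrow> int \<Rightarrow> int \<Rightarrow> nat set \<Rightarrow> int" where
  "gdegree I m n S = (\<Sum>i\<in>S. if i \<in> I then m else n)"

definition grassmann_component ::
    "nat set \<Rightarrow> int \<Rightarrow> int \<Rightarrow> int \<Rightarrow> 'a::field grassmann set" where
  "grassmann_component I m n r =
    grassmann.span {gmonom S | S. finite S \<and> gdegree I m n S = r}"

lemma grassmann_component_iff:
  "x \<in> grassmann_component I m n r \<longleftrightarrow> (\<forall>S. gcoeff x S \<noteq> 0 \<longrightarrow> gdegree I m n S = r)"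
  for x :: "'a::field grassmann"
proof
  let ?B = "{gmonom S | S. finite S \<and> gdegree I m n S = r} :: 'a grassmann set"
  let ?Z = "{x :: 'a grassmann. \<forall>S. gcoeff x S \<noteq> 0 \<longrightarrow> gdegree I m n S = r}"
  assume "x \<in> grassmann_component I m n r"
  moreover have "grassmann.span ?B \<subseteq> ?Z"
  proof (rule grassmann.span_minimal)
    show "?B \<subseteq> ?Z" by (auto simp: gcoeff_monom split: if_splits)
    show "grassmann.subspace ?Z"
      unfolding grassmann.subspace_def
    proof (intro conjI ballI allI)
      fix x y assume "x \<in> ?Z" "y \<in> ?Z"
      moreover have "gcoeff x S \<noteq> 0 \<or> gcoeff y S \<noteq> 0" if "gcoeff (x + y) S \<noteq> 0" for S
        using that by auto
      ultimately show "x + y \<in> ?Z" by blast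
    qed auto
  qed
  ultimately show "\<forall>S. gcoeff x S \<noteq> 0 \<longrightarrow> gdegree I m n S = r"
    by (auto simp: grassmann_component_def)
next
  assume x: "\<forall>S. gcoeff x S \<noteq> 0 \<longrightarrow> gdegree I m n S = r"
  let ?A = "{S. gcoeff x S \<noteq> 0}"
  have fin: "finite S" if "S \<in> ?A" for S
  proof (rule ccontr)
    assume "infinite S"
    with that show False by simp
  qed
  have coeff_sum: "gcoeff (sum f A) S = (\<Sum>T\<in>A. gcoeff (f T) S)"
    for f :: "nat set \<Rightarrow> 'a grassmann" and A S
    by (induction A rule: infinite_finite_induct) auto
  have "x = (\<Sum>S\<in>?A. gscale (gcoeff x S) (gmonom S))"
  proof (rule grassmann_eqI)
    fix S :: "nat set" assume "finite S"
    have "gcoeff (\<Sum>T\<in>?A. gscale (gcoeff x T) (gmonom T)) S =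
        (\<Sum>T\<in>?A. if T = S then gcoeff x S else 0)"
      unfolding coeff_sum by (intro sum.cong) (auto simp: gcoeff_monom \<open>finite S\<close>)
    also have "\<dots> = gcoeff x S"
      using gcoeff_finite_support[of x] by simp
    finally show "gcoeff x S = gcoeff (\<Sum>S\<in>?A. gscale (gcoeff x S) (gmonom S)) S" ..
  qed
  also have "\<dots> \<in> grassmann_component I m n r"
    unfolding grassmann_component_def
  proof (intro grassmann.span_sum grassmann.span_scale grassmann.span_base)
    fix S assume "S \<in> ?A"
    then show "gmonom S \<in> {gmonom S | S. finite S \<and> gdegree I m n S = r}"
      using x fin by blast
  qed
  finally show "x \<in> grassmann_component I m n r" .
qed

text \<open>
  An \<open>F\<close>-algebra is given here by a type of class \<open>ring_1\<close> with its scalar multiplication, and a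
  \<open>\<int>\<close>-grading by the family of its homogeneous components.
\<close>

definition algebra_iso ::
    "('f::field \<Rightarrow> 'a::ring_1 \<Rightarrow> 'a) \<Rightarrow> ('f \<Rightarrow> 'b::ring_1 \<Rightarrow> 'b) \<Rightarrow> ('a \<Rightarrow> 'b) \<Rightarrow> bool" where
  "algebra_iso sA sB \<phi> \<longleftrightarrow>
    Vector_Spaces.linear sA sB \<phi> \<and> (\<forall>x y. \<phi> (x * y) = \<phi> x * \<phi> y) \<and> \<phi> 1 = 1 \<and> bij \<phi>"

definition Z_isomorphic ::
    "('f::field \<Rightarrow> 'a::ring_1 \<Rightarrow> 'a) \<Rightarrow> (int \<Rightarrow> 'a set) \<Rightarrow>
     ('f \<Rightarrow> 'b::ring_1 \<Rightarrow> 'b) \<Rightarrow> (int \<Rightarrow> 'b set) \<Rightarrow> bool" where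
  "Z_isomorphic sA A sB B \<longleftrightarrow> (\<exists>\<phi>. algebra_iso sA sB \<phi> \<and> (\<forall>r. \<phi> ` A r = B r))"

end

theory Submission
  imports Defs "HOL-Library.Infinite_Set"
begin

text \<open>
  Let \<open>J\<close> be the span of the monomials other than 1. The quotient \<open>J / J\<^sup>2\<close> is an invariant of
  the algebra, and it inherits the grading: the classes of the generators form a basis, so its
  only degrees are \<open>m\<close> and \<open>n\<close>. A graded isomorphism therefore preserves the set \<open>{m, n}\<close>, and
  the signs of \<open>m\<close> and \<open>n\<close> tell them apart. In coordinates, \<open>x \<in> J\<close> means that the coefficient
  of \<open>x\<close> at \<open>{}\<close> vanishes, and \<open>x \<in> J\<^sup>2\<close> that those at singletons vanish as well. A homomorphism
  maps \<open>J\<close> into \<open>J\<close> because a nontrivial monomial has square 0 and the coefficient at \<open>{}\<close> is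
  multiplicative; hence it maps \<open>J\<^sup>2\<close> into \<open>J\<^sup>2\<close>
  (\<open>hom_preserves_no_linear_part\<close>). Applied to the inverse of an isomorphism, this shows that
  the image of a generator has a nonzero coefficient at some generator, which then has the same
  degree (\<open>iso_ggen_has_linear_part\<close>, \<open>graded_iso_degree\<close>).

  Conversely, when the degrees agree, only the splittings of the set of generators differ. Both
  parts are countably infinite, so some permutation of the generators carries one splitting to the
  other. The permutation extends to an automorphism of the algebra, in which a monomial picks up
  the sign of the rearrangement of its factors (\<open>algebra_iso_permute\<close>).
\<close>

section \<open>The linear part is invariant under isomorphisms\<close>

lemma gcoeff_sum: "gcoeff (sum f A) S = (\<Sum>T\<in>A. gcoeff (f T) S)"
  for f :: "'b \<Rightarrow> 'a::ab_group_add grassmann"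
  by (induction A rule: infinite_finite_induct) auto

lemma grassmann_expansion:
  "x = (\<Sum>S | gcoeff x S \<noteq> 0. gscale (gcoeff x S) (gmonom S))"
  for x :: "'a::comm_ring_1 grassmann"
proof (rule grassmann_eqI)
  fix S :: "nat set" assume S: "finite S"
  have "gcoeff (\<Sum>T | gcoeff x T \<noteq> 0. gscale (gcoeff x T) (gmonom T)) S =
      (\<Sum>T | gcoeff x T \<noteq> 0. if T = S then gcoeff x S else 0)"
    unfolding gcoeff_sum by (intro sum.cong) (auto simp: gcoeff_monom S)
  also have "\<dots> = gcoeff x S"
    using gcoeff_finite_support[of x] by simp
  finally show "gcoeff x S =
    gcoeff (\<Sum>T | gcoeff x T \<noteq> 0. gscale (gcoeff x T) (gmonom T)) S" ..
qed

lemma gcoeff_mult_empty: "gcoeff (x * y) {} = gcoeff x {} * gcoeff y {}"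
  by (simp add: gcoeff_mult)

lemma gcoeff_mult_singleton:
  "gcoeff (x * y) {i} = gcoeff x {} * gcoeff y {i} + gcoeff x {i} * gcoeff y {}"
  by (simp add: gcoeff_mult Pow_insert)

lemma hom_monom_no_constant_part:
  fixes \<psi> :: "'a::field grassmann \<Rightarrow> 'b::field grassmann"
  assumes mult: "\<And>x y. \<psi> (x * y) = \<psi> x * \<psi> y" and zero: "\<psi> 0 = 0"
    and S: "finite S" "S \<noteq> {}"
  shows "gcoeff (\<psi> (gmonom S)) {} = 0"
proof -
  have "\<psi> (gmonom S) * \<psi> (gmonom S) = \<psi> (gmonom S * gmonom S)" by (simp add: mult)
  also have "\<dots> = 0" using S by (simp add: gmonom_mult zero)
  finally have "gcoeff (\<psi> (gmonom S)) {} * gcoeff (\<psi> (gmonom S)) {} = 0"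
    by (simp flip: gcoeff_mult_empty)
  then show ?thesis by simp
qed

text \<open>
  A monomial of length at least 2 is, up to sign, the product of two nontrivial monomials. Their
  images have no constant part, and a product of two such elements has no linear part.
\<close>

lemma hom_preserves_no_linear_part:
  fixes \<psi> :: "'a::field grassmann \<Rightarrow> 'a grassmann"
  assumes lin: "Vector_Spaces.linear gscale gscale \<psi>"
    and mult: "\<And>x y. \<psi> (x * y) = \<psi> x * \<psi> y"
    and x: "gcoeff x {} = 0" "\<And>j. gcoeff x {j} = 0"
  shows "gcoeff (\<psi> x) {i} = 0"
proof -
  interpret \<psi>: Vector_Spaces.linear gscale gscale \<psi> by (rule lin)
  have monom: "gcoeff (\<psi> (gmonom S)) {i} = 0" if S: "gcoeff x S \<noteq> 0" for S
  proof -
    have "finite S" using S by (metis gcoeff_infinite)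
    moreover obtain a where "a \<in> S" using S x(1) by (metis ex_in_conv)
    moreover define T where "T = S - {a}"
    ultimately have T: "S = insert a T" "a \<notin> T" "finite T" by auto
    with S x(2) have "T \<noteq> {}" by auto
    let ?p = "ggen a * gmonom T :: 'a grassmann" and ?c = "gsign {a} T :: 'a"
    have "gscale ?c ?p = gscale (?c * ?c) (gmonom S)"
      using T by (simp add: gmonom_mult)
    also have "?c * ?c = 1"
      by (simp add: gsign_def flip: power_add)
    finally have "\<psi> (gmonom S) = gscale ?c (\<psi> (ggen a) * \<psi> (gmonom T))"
      by (metis grassmann.scale_one \<psi>.scale mult)
    moreover have "gcoeff (\<psi> (ggen a)) {} = 0" "gcoeff (\<psi> (gmonom T)) {} = 0"
      using T \<open>T \<noteq> {}\<close> by (auto intro!: hom_monom_no_constant_part mult \<psi>.zero)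
    ultimately show ?thesis
      by (simp add: gcoeff_mult_singleton)
  qed
  have "\<psi> x = (\<Sum>S | gcoeff x S \<noteq> 0. gscale (gcoeff x S) (\<psi> (gmonom S)))"
    by (subst grassmann_expansion[of x]) (simp add: \<psi>.sum \<psi>.scale)
  then show ?thesis
    by (simp add: gcoeff_sum monom)
qed

lemma algebra_iso_inv:
  assumes "algebra_iso sA sB \<phi>"
  shows "algebra_iso sB sA (inv \<phi>)"
proof -
  have lin: "Vector_Spaces.linear sA sB \<phi>" and mult: "\<And>x y. \<phi> (x * y) = \<phi> x * \<phi> y"
    and one: "\<phi> 1 = 1" and bij: "bij \<phi>"
    using assms by (auto simp: algebra_iso_def)
  interpret \<phi>: Vector_Spaces.linear sA sB \<phi> by (rule lin)
  have inv: "inv \<phi> (\<phi> x) = x" "\<phi> (inv \<phi> y) = y" for x y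
    using bij by (simp_all add: bij_is_inj bij_is_surj surj_f_inv_f)
  have "inv \<phi> (x + y) = inv \<phi> x + inv \<phi> y" "inv \<phi> (sB c x) = sA c (inv \<phi> x)" for x y c
    by (metis inv \<phi>.add, metis inv \<phi>.scale)
  then have "Vector_Spaces.linear sB sA (inv \<phi>)"
    by unfold_locales
  moreover have "inv \<phi> (x * y) = inv \<phi> x * inv \<phi> y" for x y
    by (metis inv mult)
  moreover have "inv \<phi> 1 = 1" by (metis inv(1) one)
  moreover have "bij (inv \<phi>)" using bij by (rule bij_imp_bij_inv)
  ultimately show ?thesis
    unfolding algebra_iso_def by blast
qed

lemma iso_ggen_has_linear_part:
  fixes \<phi> :: "'a::field grassmann \<Rightarrow> 'a grassmann"
  assumes "algebra_iso gscale gscale \<phi>"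
  obtains j where "gcoeff (\<phi> (ggen i)) {j} \<noteq> 0"
proof (rule ccontr)
  assume "\<not> thesis"
  with that have no_linear: "gcoeff (\<phi> (ggen i)) {j} = 0" for j by blast
  have lin: "Vector_Spaces.linear gscale gscale \<phi>"
    and mult: "\<And>x y. \<phi> (x * y) = \<phi> x * \<phi> y" and "bij \<phi>"
    using assms by (auto simp: algebra_iso_def)
  interpret \<phi>: Vector_Spaces.linear gscale gscale \<phi> by (rule lin)
  have "gcoeff (\<phi> (ggen i)) {} = 0"
    by (rule hom_monom_no_constant_part) (auto simp: mult \<phi>.zero)
  then have "gcoeff (inv \<phi> (\<phi> (ggen i))) {i} = 0"
    using algebra_iso_inv[OF assms] no_linear
    by (simp add: algebra_iso_def hom_preserves_no_linear_part)
  then show False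
    using \<open>bij \<phi>\<close> by (simp add: bij_is_inj gcoeff_monom)
qed

lemma graded_iso_degree:
  fixes \<phi> :: "'a::field grassmann \<Rightarrow> 'a grassmann"
  assumes iso: "algebra_iso gscale gscale \<phi>"
    and graded: "\<And>r. \<phi> ` grassmann_component I1 m1 n1 r = grassmann_component I2 m2 n2 r"
  shows "(if i \<in> I1 then m1 else n1) \<in> {m2, n2}"
proof -
  let ?r = "if i \<in> I1 then m1 else n1"
  have "ggen i \<in> grassmann_component I1 m1 n1 ?r"
    by (auto simp: grassmann_component_iff gcoeff_monom gdegree_def split: if_splits)
  then have "\<phi> (ggen i) \<in> grassmann_component I2 m2 n2 ?r"
    using graded by blast
  moreover obtain j where "gcoeff (\<phi> (ggen i)) {j} \<noteq> 0"
    using iso by (rule iso_ggen_has_linear_part)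
  ultimately have "gdegree I2 m2 n2 {j} = ?r"
    by (auto simp: grassmann_component_iff)
  then show ?thesis by (auto simp: gdegree_def split: if_splits)
qed

section \<open>Permuting the generators\<close>

definition perm_inversions :: "(nat \<Rightarrow> nat) \<Rightarrow> nat set \<Rightarrow> (nat \<times> nat) set" where
  "perm_inversions q S = {(s, t). s \<in> S \<and> t \<in> S \<and> s < t \<and> q t < q s}"

definition perm_sign :: "(nat \<Rightarrow> nat) \<Rightarrow> nat set \<Rightarrow> 'a::ring_1" where
  "perm_sign q S = (-1) ^ card (perm_inversions q S)"

lemma finite_perm_inversions: "finite S \<Longrightarrow> finite (perm_inversions q S)"
  by (rule finite_subset[of _ "S \<times> S"]) (auto simp: perm_inversions_def)

lemma perm_sign_empty [simp]: "perm_sign q {} = 1"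
  by (simp add: perm_sign_def perm_inversions_def)

lemma perm_sign_square [simp]: "perm_sign q S * perm_sign q S = 1"
  by (simp add: perm_sign_def flip: power_add)

lemma perm_sign_inv:
  assumes "bij q"
  shows "perm_sign (inv q) (q ` S) = perm_sign q S"
proof -
  have inv: "inv q (q s) = s" for s
    using assms by (simp add: bij_is_inj)
  have "perm_inversions (inv q) (q ` S) = (\<lambda>(s, t). (q t, q s)) ` perm_inversions q S"
    by (force simp: perm_inversions_def inv)
  moreover have "inj_on (\<lambda>(s, t). (q t, q s)) (perm_inversions q S)"
    using assms by (auto simp: inj_on_def dest: injD[OF bij_is_inj])
  ultimately show ?thesis
    by (simp add: perm_sign_def card_image)
qed

text \<open>
  The compatibility of the two signs that makes permuting generators multiplicative. A pair with
  one entry in \<open>S\<close> and one in \<open>T\<close> has its order reversed by \<open>q\<close> exactly if it is counted by one,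
  but not both, of the signs of \<open>(S, T)\<close> and \<open>(q ` S, q ` T)\<close>.
\<close>

lemma perm_sign_union:
  assumes q: "inj q" and fin: "finite S" "finite T" and disj: "S \<inter> T = {}"
  shows "perm_sign q (S \<union> T) * gsign (q ` S) (q ` T) =
    gsign S T * perm_sign q S * (perm_sign q T :: 'a::comm_ring_1)"
proof -
  define A where "A = ginversions S T"
  define B where "B = {(s, t). s \<in> S \<and> t \<in> T \<and> q t < q s}"
  define C where "C = {(s, t). (s \<in> S \<and> t \<in> T \<or> s \<in> T \<and> t \<in> S) \<and> s < t \<and> q t < q s}"
  have finAB: "finite A" "finite B"
    by (rule finite_subset[of _ "S \<times> T"];
      use fin in \<open>auto simp: A_def B_def ginversions_def\<close>)+
  have finC: "finite C"
    by (rule finite_subset[of _ "(S \<union> T) \<times> (S \<union> T)"]) (use fin in \<open>auto simp: C_def\<close>)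
  have gB: "card (ginversions (q ` S) (q ` T)) = card B"
  proof -
    have "ginversions (q ` S) (q ` T) = map_prod q q ` B"
      by (auto simp: ginversions_def B_def image_iff)
    moreover have "inj_on (map_prod q q) B"
      using q by (meson inj_on_subset prod.inj_map subset_UNIV)
    ultimately show ?thesis by (simp add: card_image)
  qed
  have "perm_inversions q (S \<union> T) = (perm_inversions q S \<union> perm_inversions q T) \<union> C"
    by (auto simp: perm_inversions_def C_def)
  moreover have "perm_inversions q S \<inter> perm_inversions q T = {}"
    "(perm_inversions q S \<union> perm_inversions q T) \<inter> C = {}"
    using disj by (auto simp: perm_inversions_def C_def)
  ultimately have split: "card (perm_inversions q (S \<union> T)) =
      card (perm_inversions q S) + card (perm_inversions q T) + card C"
    using fin finC by (simp add: card_Un_disjoint finite_perm_inversions)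
  \<comment> \<open>Writing the entry from \<open>S\<close> first turns \<open>C\<close> into the symmetric difference of \<open>A\<close> and \<open>B\<close>.\<close>
  have "card C = card ((A - B) \<union> (B - A))"
  proof (rule bij_betw_same_card[of "\<lambda>(s, t). if s \<in> S then (s, t) else (t, s)"],
      rule bij_betw_byWitness[where f' = "\<lambda>(s, t). if s < t then (s, t) else (t, s)"])
    show "(\<lambda>(s, t). if s \<in> S then (s, t) else (t, s)) ` C \<subseteq> (A - B) \<union> (B - A)"
      using disj by (auto simp: A_def B_def C_def ginversions_def split: if_splits)
    show "(\<lambda>(s, t). if s < t then (s, t) else (t, s)) ` ((A - B) \<union> (B - A)) \<subseteq> C"
    proof (rule image_subsetI)
      fix p assume "p \<in> (A - B) \<union> (B - A)"
      then obtain s t where p: "p = (s, t)" "s \<in> S" "t \<in> T" "t < s \<longleftrightarrow> \<not> q t < q s"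
        by (cases p) (auto simp: A_def B_def ginversions_def)
      moreover have "s \<noteq> t" using p disj by blast
      moreover from this have "q s \<noteq> q t" using q by (simp add: inj_eq)
      ultimately show "(case p of (s, t) \<Rightarrow> if s < t then (s, t) else (t, s)) \<in> C"
        by (cases "s < t") (simp_all add: C_def)
    qed
    show "\<forall>p\<in>C. (\<lambda>(s, t). if s < t then (s, t) else (t, s))
        ((\<lambda>(s, t). if s \<in> S then (s, t) else (t, s)) p) = p"
      by (auto simp: C_def)
    show "\<forall>p\<in>(A - B) \<union> (B - A). (\<lambda>(s, t). if s \<in> S then (s, t) else (t, s))
        ((\<lambda>(s, t). if s < t then (s, t) else (t, s)) p) = p"
    proof
      fix p assume "p \<in> (A - B) \<union> (B - A)"
      then obtain s t where "p = (s, t)" "s \<in> S" "t \<in> T"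
        by (auto simp: A_def B_def ginversions_def)
      moreover from this have "t \<notin> S" using disj by blast
      ultimately show "(\<lambda>(s, t). if s \<in> S then (s, t) else (t, s))
          ((\<lambda>(s, t). if s < t then (s, t) else (t, s)) p) = p"
        by simp
    qed
  qed
  also have "\<dots> = card (A - B) + card (B - A)"
    using finAB by (intro card_Un_disjoint) auto
  finally have "card C + 2 * card (A \<inter> B) = card A + card B"
    using card_Int_Diff[OF finAB(1), of B] card_Int_Diff[OF finAB(2), of A]
    by (simp add: Int_commute)
  then have "even (card C + card B) \<longleftrightarrow> even (card A)"
    by presburger
  then have signs: "(-1) ^ card A = (-1) ^ card C * ((-1) ^ card B :: 'a)"
    by (auto simp: minus_one_power_iff)
  then show ?thesis
    unfolding perm_sign_def gsign_def split gB A_def[symmetric]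
    by (simp add: signs power_add mult_ac)
qed

text \<open>
  For bijective \<open>q\<close> this is the algebra map that sends the generator \<open>q i\<close> to the generator \<open>i\<close>;
  on coordinates it acts by pulling back along \<open>q\<close>, so that no inverse of \<open>q\<close> appears. For the
  other \<open>q\<close>, where the pulled back family may have infinite support, it is set to 0.
\<close>

lift_definition gpermute :: "(nat \<Rightarrow> nat) \<Rightarrow> 'a::comm_ring_1 grassmann \<Rightarrow> 'a grassmann"
  is "\<lambda>q f U. if bij q then perm_sign q U * f (q ` U) else 0"
proof -
  fix q :: "nat \<Rightarrow> nat" and f :: "nat set \<Rightarrow> 'a"
  assume f: "finite {S. f S \<noteq> 0} \<and> (\<forall>S. f S \<noteq> 0 \<longrightarrow> finite S)"
  let ?h = "\<lambda>U. if bij q then perm_sign q U * f (q ` U) else 0"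
  show "finite {U. ?h U \<noteq> 0} \<and> (\<forall>U. ?h U \<noteq> 0 \<longrightarrow> finite U)"
  proof (cases "bij q")
    case True
    then have "inj ((`) q)" by (metis bij_is_inj inj_image_eq_iff injI)
    then have "finite ((`) q -` {S. f S \<noteq> 0})" using f by (blast intro: finite_vimageI)
    then have "finite {U. ?h U \<noteq> 0}" by (rule finite_subset[rotated]) (auto split: if_splits)
    moreover have "finite U" if "?h U \<noteq> 0" for U
    proof (rule finite_imageD)
      have "f (q ` U) \<noteq> 0" using that by (auto split: if_splits)
      then show "finite (q ` U)" using f by blast
      show "inj_on q U" using True by (meson bij_is_inj inj_on_subset subset_UNIV)
    qed
    ultimately show ?thesis by blast
  qed simp
qed

lemma gcoeff_permute: "bij q \<Longrightarrow> gcoeff (gpermute q x) U = perm_sign q U * gcoeff x (q ` U)"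
  by transfer simp

lemma gpermute_inv:
  assumes "bij q"
  shows "gpermute q (gpermute (inv q) x) = x"
proof (rule grassmann_eqI)
  fix U :: "nat set"
  have "inv q ` q ` U = U" using assms by (simp add: bij_is_inj image_inv_f_f)
  with assms have "gcoeff (gpermute q (gpermute (inv q) x)) U =
      (perm_sign q U * perm_sign q U) * gcoeff x U"
    by (simp add: gcoeff_permute bij_imp_bij_inv perm_sign_inv flip: mult.assoc)
  then show "gcoeff (gpermute q (gpermute (inv q) x)) U = gcoeff x U" by simp
qed

lemma gpermute_mult:
  fixes x y :: "'a::comm_ring_1 grassmann"
  assumes q: "bij q"
  shows "gpermute q (x * y) = gpermute q x * gpermute q y"
proof (rule grassmann_eqI)
  fix U :: "nat set" assume U: "finite U"
  have inj: "inj q" using q by (rule bij_is_inj)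
  have "gcoeff (gpermute q (x * y)) U = (\<Sum>S\<in>(`) q ` Pow U.
      perm_sign q U * (gsign S (q ` U - S) * gcoeff x S * gcoeff y (q ` U - S)))"
    by (simp add: gcoeff_permute q gcoeff_mult sum_distrib_left image_Pow_surj)
  also have "\<dots> = (\<Sum>S\<in>Pow U. perm_sign q U *
      (gsign (q ` S) (q ` U - q ` S) * gcoeff x (q ` S) * gcoeff y (q ` U - q ` S)))"
    using inj by (subst sum.reindex) (auto simp: inj_on_def inj_image_eq_iff)
  also have "\<dots> = (\<Sum>S\<in>Pow U. gsign S (U - S) * gcoeff (gpermute q x) S *
      gcoeff (gpermute q y) (U - S))"
  proof (rule sum.cong)
    fix S assume "S \<in> Pow U"
    then have S: "S \<union> (U - S) = U" "finite S" "finite (U - S)"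
      using U finite_subset by auto
    have "perm_sign q U * gsign (q ` S) (q ` (U - S)) =
        gsign S (U - S) * perm_sign q S * (perm_sign q (U - S) :: 'a)"
      using perm_sign_union[OF inj S(2,3)] S(1) by auto
    then have "perm_sign q U * gsign (q ` S) (q ` (U - S)) *
          (gcoeff x (q ` S) * gcoeff y (q ` (U - S))) =
        gsign S (U - S) * perm_sign q S * perm_sign q (U - S) *
          (gcoeff x (q ` S) * gcoeff y (q ` (U - S)))"
      by simp
    then show "perm_sign q U *
        (gsign (q ` S) (q ` U - q ` S) * gcoeff x (q ` S) * gcoeff y (q ` U - q ` S)) =
      gsign S (U - S) * gcoeff (gpermute q x) S * gcoeff (gpermute q y) (U - S)"
      by (simp add: gcoeff_permute q image_set_diff[OF inj] mult_ac)
  qed simp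
  also have "\<dots> = gcoeff (gpermute q x * gpermute q y) U"
    by (simp add: gcoeff_mult)
  finally show "gcoeff (gpermute q (x * y)) U = gcoeff (gpermute q x * gpermute q y) U" .
qed

lemma algebra_iso_permute:
  assumes q: "bij q"
  shows "algebra_iso gscale gscale (gpermute q :: 'a::field grassmann \<Rightarrow> 'a grassmann)"
proof -
  have "gpermute q (x + y) = gpermute q x + (gpermute q y :: 'a grassmann)"
    "gpermute q (gscale c x) = gscale c (gpermute q x :: 'a grassmann)" for x y c
    by (rule grassmann_eqI; simp add: gcoeff_permute q algebra_simps)+
  then have "Vector_Spaces.linear gscale gscale (gpermute q :: 'a grassmann \<Rightarrow> 'a grassmann)"
    by unfold_locales
  moreover have "gpermute q 1 = (1 :: 'a grassmann)"
    by (rule grassmann_eqI) (simp add: gcoeff_permute q gcoeff_one)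
  moreover have "bij (gpermute q :: 'a grassmann \<Rightarrow> 'a grassmann)"
  proof (rule o_bij)
    show "gpermute q \<circ> gpermute (inv q) = (id :: 'a grassmann \<Rightarrow> _)"
      by (simp add: fun_eq_iff gpermute_inv q)
    show "gpermute (inv q) \<circ> gpermute q = (id :: 'a grassmann \<Rightarrow> _)"
      using gpermute_inv[OF bij_imp_bij_inv[OF q], where 'a = 'a]
      by (simp add: fun_eq_iff inv_inv_eq q)
  qed
  ultimately show ?thesis
    unfolding algebra_iso_def using gpermute_mult[OF q] by blast
qed

lemma gpermute_component:
  assumes q: "bij q" and I: "\<And>i. q i \<in> I1 \<longleftrightarrow> i \<in> I2"
  shows "gpermute q ` grassmann_component I1 m n r =
    (grassmann_component I2 m n r :: 'a::field grassmann set)"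
proof -
  have deg: "gdegree I1 m n (q ` U) = gdegree I2 m n U" for U
    using q I unfolding gdegree_def
    by (subst sum.reindex) (auto intro: inj_on_subset[OF bij_is_inj])
  have nonzero: "perm_sign q U \<noteq> (0 :: 'a)" for U
    by (simp add: perm_sign_def)
  have mem: "gpermute q x \<in> grassmann_component I2 m n r \<longleftrightarrow> x \<in> grassmann_component I1 m n r"
    for x :: "'a grassmann"
  proof -
    have "x \<in> grassmann_component I1 m n r \<longleftrightarrow>
        (\<forall>U. gcoeff x (q ` U) \<noteq> 0 \<longrightarrow> gdegree I1 m n (q ` U) = r)"
      unfolding grassmann_component_iff using q
      by (metis bij_is_surj image_f_inv_f)
    then show ?thesis
      by (simp add: grassmann_component_iff gcoeff_permute q nonzero deg)
  qed
  then show ?thesis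
    using gpermute_inv[OF q] by (metis (no_types, lifting) image_iff subsetI subset_antisym)
qed

lemma ex_permutation_matching_splittings:
  fixes I1 I2 :: "nat set"
  assumes "infinite I1" "infinite (- I1)" "infinite I2" "infinite (- I2)"
  obtains q where "bij q" "\<And>i. q i \<in> I1 \<longleftrightarrow> i \<in> I2"
proof -
  have ex: "\<exists>f. bij_betw f A B" if "infinite A" "infinite B" for A B :: "nat set"
    using that by (meson bij_betw_inv bij_betw_trans bij_enumerate)
  obtain f g where fg: "bij_betw f I2 I1" "bij_betw g (- I2) (- I1)"
    using ex assms by meson
  define q where "q i = (if i \<in> I2 then f i else g i)" for i
  have "bij_betw q (I2 \<union> - I2) (I1 \<union> - I1)"
  proof (rule bij_betw_combine)
    show "bij_betw q I2 I1"
      using fg(1) by (rule bij_betw_cong[THEN iffD1, rotated]) (simp add: q_def)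
    show "bij_betw q (- I2) (- I1)"
      using fg(2) by (rule bij_betw_cong[THEN iffD1, rotated]) (simp add: q_def)
  qed simp
  then have "bij q" by simp
  moreover have "q i \<in> I1 \<longleftrightarrow> i \<in> I2" for i
    using bij_betwE[OF fg(1)] bij_betwE[OF fg(2)] by (auto simp: q_def)
  ultimately show thesis by (rule that)
qed

section \<open>Classification of the gradings\<close>

theorem theorem4p2:
  fixes m1 n1 m2 n2 :: int and I1 I2 :: "nat set"
  assumes "m1 < 0" "0 < n1" "m2 < 0" "0 < n2"
    and "infinite I1" "infinite (- I1)" "infinite I2" "infinite (- I2)"
  shows "Z_isomorphic
      (gscale :: 'a::field_char_0 \<Rightarrow> 'a grassmann \<Rightarrow> 'a grassmann) (grassmann_component I1 m1 n1)
      (gscale :: 'a \<Rightarrow> 'a grassmann \<Rightarrow> 'a grassmann) (grassmann_component I2 m2 n2)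
    \<longleftrightarrow> m1 = m2 \<and> n1 = n2"
proof
  assume "Z_isomorphic
      (gscale :: 'a \<Rightarrow> 'a grassmann \<Rightarrow> 'a grassmann) (grassmann_component I1 m1 n1)
      (gscale :: 'a \<Rightarrow> 'a grassmann \<Rightarrow> 'a grassmann) (grassmann_component I2 m2 n2)"
  then obtain \<phi> :: "'a grassmann \<Rightarrow> 'a grassmann" where "algebra_iso gscale gscale \<phi>"
    "\<And>r. \<phi> ` grassmann_component I1 m1 n1 r = grassmann_component I2 m2 n2 r"
    by (auto simp: Z_isomorphic_def)
  then have degree: "(if i \<in> I1 then m1 else n1) \<in> {m2, n2}" for i
    by (rule graded_iso_degree)
  obtain i j where "i \<in> I1" "j \<notin> I1"
    using assms(5,6) by (metis ComplD ex_in_conv finite.emptyI)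
  then show "m1 = m2 \<and> n1 = n2"
    using degree[of i] degree[of j] assms(1-4) by auto
next
  assume eq: "m1 = m2 \<and> n1 = n2"
  obtain q where "bij q" "\<And>i. q i \<in> I1 \<longleftrightarrow> i \<in> I2"
    using assms(5-8) by (rule ex_permutation_matching_splittings) blast
  then show "Z_isomorphic
      (gscale :: 'a \<Rightarrow> 'a grassmann \<Rightarrow> 'a grassmann) (grassmann_component I1 m1 n1)
      (gscale :: 'a \<Rightarrow> 'a grassmann \<Rightarrow> 'a grassmann) (grassmann_component I2 m2 n2)"
    using eq algebra_iso_permute gpermute_component unfolding Z_isomorphic_def by blast
qed

end
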